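(* For every formula $\varphi\in\mathcal L$: $\models_{\mathsf{InqI}}\varphi$ if and only if $\models_{\mathsf{S4}\text{-}\mathsf{MT}_0}\varphi^\Box$, where the translation $(\cdot)^\Box:\mathcal L\to\mathcal L_d$ is defined inductively by $p^\Box=\Box p$, $\bot^\Box=\Box\bot$, $(\varphi\land\psi)^\Box=\varphi^\Box\land\psi^\Box$, $(\varphi\lor\psi)^\Box=\varphi^\Box\lor\psi^\Box$, $(\varphi\sqcup\psi)^\Box=\varphi^\Box\sqcup\psi^\Box$, and $(\varphi\to\psi)^\Box=\Box(\varphi^\Box\to\psi^\Box)$.
   Context: Fix a set $\mathcal P$ of atomic sentences. The language $\mathcal L$ is given by $\varphi::=p\mid\bot\mid\varphi\land\varphi\mid\varphi\lor\varphi\mid\varphi\to\varphi\mid\varphi\sqcup\varphi$ with $p\in\mathcal P$, where $\lor$ is standard disjunction and $\sqcup$ denotes inquisitive disjunction. Logic $\mathsf{InqI}$. An intuitionistic Kripke model is $M=\langle W,R,V\rangle$ with $W$ a set (of worlds), $R$ a partial order on $W$, and $V:W\times\mathcal P\to\{0,1\}$ such that $wRw'$ and $V(w,p)=1$ imply $V(w',p)=1$. A team is a set $t\subseteq W$; $R[w]=\{w'\mid wRw'\}$ and $R[t]=\bigcup_{w\in t}R[w]$. Support $M,t\models\varphi$ is defined by: - $M,t\models p$ iff $V(w,p)=1$ for all $w\in t$; - $M,t\models\bot$ iff $t=\emptyset$; - $M,t\models\varphi\land\psi$ iff $M,t\models\varphi$ and $M,t\models\psi$; - $M,t\models\varphi\lor\psi$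 iff there are $t',t''$ with $t=t'\cup t''$, $M,t'\models\varphi$ and $M,t''\models\psi$; - $M,t\models\varphi\to\psi$ iff for all $t'\subseteq R[t]$, $M,t'\models\varphi$ implies $M,t'\models\psi$; - $M,t\models\varphi\sqcup\psi$ iff $M,t\models\varphi$ or $M,t\models\psi$. $\models_{\mathsf{InqI}}\varphi$ means $M,t\models\varphi$ for all intuitionistic Kripke models $M$ and teams $t$. Logic $\mathsf{S4}\text{-}\mathsf{MT}_0$. The language $\mathcal L_d$ is given by $\varphi::=p\mid\bot\mid{=}(p_1,\dots,p_n,q)\mid\varphi\land\varphi\mid\varphi\lor\varphi\mid\varphi\to\varphi\mid\varphi\sqcup\varphi\mid\Box\varphi\mid\Diamond\varphi$. A modal Kripke model is $M=\langle W,R,V\rangle$ with $W$ a set, $R$ a binary relation on $W$ and $V:W\times\mathcal P\to\{0,1\}$ any function; it is an $\mathsf{S4}$-modal Kripke model if $R$ is reflexive and transitive. Teams are sets $t\subseteq W$, with $R[w]=\{w'\mid wRw'\}$ and $R[t]=\bigcup_{w\in t}R[w]$; for teams $t,t'$, write $tRt'$ iff $t'\subseteq R[t]$ and $R[w]\cap t'\neq\emptyset$ for all $w\in t$. Satisfaction $M,t\models\varphi$ for $\varphi\in\mathcal L_d$ is defined by: - $M,t\models p$ iff $V(w,p)=1$ for all $w\in t$; - $M,t\models\bot$ iff $t=\emptyset$; - $M,t\models\varphi\land\psi$ iff $M,t\models\varphi$ and $M,t\models\psi$; - $M,t\models\varphi\lor\psi$ iff there are $t',t''$ with $t=t'\cup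 t''$, $M,t'\models\varphi$ and $M,t''\models\psi$; - $M,t\models\varphi\sqcup\psi$ iff $M,t\models\varphi$ or $M,t\models\psi$; - $M,t\models{=}(p_1,\dots,p_n,q)$ iff for all $w,w'\in t$, if $V(w,p_i)=V(w',p_i)$ for all $1\le i\le n$ then $V(w,q)=V(w',q)$; - $M,t\models\varphi\to\psi$ iff for all $t'\subseteq t$, $M,t'\models\varphi$ implies $M,t'\models\psi$; - $M,t\models\Diamond\varphi$ iff there is $t'$ with $tRt'$ and $M,t'\models\varphi$; - $M,t\models\Box\varphi$ iff for all $t'$, $tRt'$ implies $M,t'\models\varphi$. $\models_{\mathsf{S4}\text{-}\mathsf{MT}_0}\varphi$ means $M,t\models\varphi$ for all $\mathsf{S4}$-modal Kripke models $M$ and teams $t$. *)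

theory Defs
  imports Main
begin

text \<open>
  The type variable \<open>'p\<close> plays the role of the set of atomic sentences, and \<open>'w\<close> that of the
  universe from which worlds are drawn. The set of worlds of a model is an arbitrary, possibly
  empty, subset of \<open>'w\<close>; values of the valuation outside it are irrelevant.
\<close>

record ('w, 'p) kripke =
  worlds :: "'w set"
  acc :: "'w rel"
  val :: "'w \<Rightarrow> 'p \<Rightarrow> bool"

definition int_model :: "('w, 'p) kripke \<Rightarrow> bool" where
  "int_model M \<longleftrightarrow> partial_order_on (worlds M) (acc M) \<and>
     (\<forall>w w' p. (w, w') \<in> acc M \<longrightarrow> val M w p \<longrightarrow> val M w' p)"

definition modal_model :: "('w, 'p) kripke \<Rightarrow> bool" where
  "modal_model M \<longleftrightarrow> acc M \<subseteq> worlds M \<times> worlds M"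

definition s4_model :: "('w, 'p) kripke \<Rightarrow> bool" where
  "s4_model M \<longleftrightarrow> modal_model M \<and> refl_on (worlds M) (acc M) \<and> trans (acc M)"

datatype 'p fm =
    Atom 'p
  | Bot
  | And "'p fm" "'p fm"
  | Or "'p fm" "'p fm"
  | Imp "'p fm" "'p fm"
  | IOr "'p fm" "'p fm"  \<comment> \<open>inquisitive disjunction\<close>

fun inqi_support :: "('w, 'p) kripke \<Rightarrow> 'w set \<Rightarrow> 'p fm \<Rightarrow> bool" where
  "inqi_support M t (Atom p) \<longleftrightarrow> (\<forall>w\<in>t. val M w p)"
| "inqi_support M t Bot \<longleftrightarrow> t = {}"
| "inqi_support M t (And \<phi> \<psi>) \<longleftrightarrow> inqi_support M t \<phi> \<and> inqi_support M t \<psi>"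
| "inqi_support M t (Or \<phi> \<psi>) \<longleftrightarrow>
     (\<exists>t' t''. t = t' \<union> t'' \<and> inqi_support M t' \<phi> \<and> inqi_support M t'' \<psi>)"
| "inqi_support M t (Imp \<phi> \<psi>) \<longleftrightarrow>
     (\<forall>t' \<subseteq> acc M `` t. inqi_support M t' \<phi> \<longrightarrow> inqi_support M t' \<psi>)"
| "inqi_support M t (IOr \<phi> \<psi>) \<longleftrightarrow> inqi_support M t \<phi> \<or> inqi_support M t \<psi>"

text \<open>
  HOL cannot quantify over types inside a formula, so validity takes the universe of worlds as a
  type argument.
\<close>

definition inqi_valid :: "'w itself \<Rightarrow> 'p fm \<Rightarrow> bool" where
  "inqi_valid (_ :: 'w itself) \<phi> \<longleftrightarrow>
     (\<forall>(M :: ('w, 'p) kripke) t. int_model M \<longrightarrow> t \<subseteq> worlds M \<longrightarrow> inqi_support M t \<phi>)"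

datatype 'p mfm =
    MAtom 'p
  | MBot
  | MDep "'p list" 'p  \<comment> \<open>\<open>MDep [p\<^sub>1, \<dots>, p\<^sub>n] q\<close> is the dependence atom \<open>=(p\<^sub>1, \<dots>, p\<^sub>n, q)\<close>\<close>
  | MAnd "'p mfm" "'p mfm"
  | MOr "'p mfm" "'p mfm"
  | MImp "'p mfm" "'p mfm"
  | MIOr "'p mfm" "'p mfm"
  | MBox "'p mfm"
  | MDia "'p mfm"

definition team_acc :: "('w, 'p) kripke \<Rightarrow> 'w set \<Rightarrow> 'w set \<Rightarrow> bool" where
  "team_acc M t t' \<longleftrightarrow> t' \<subseteq> acc M `` t \<and> (\<forall>w\<in>t. acc M `` {w} \<inter> t' \<noteq> {})"

fun mt_sat :: "('w, 'p) kripke \<Rightarrow> 'w set \<Rightarrow> 'p mfm \<Rightarrow> bool" where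
  "mt_sat M t (MAtom p) \<longleftrightarrow> (\<forall>w\<in>t. val M w p)"
| "mt_sat M t MBot \<longleftrightarrow> t = {}"
| "mt_sat M t (MDep ps q) \<longleftrightarrow>
     (\<forall>w\<in>t. \<forall>w'\<in>t. (\<forall>p\<in>set ps. val M w p = val M w' p) \<longrightarrow> val M w q = val M w' q)"
| "mt_sat M t (MAnd \<phi> \<psi>) \<longleftrightarrow> mt_sat M t \<phi> \<and> mt_sat M t \<psi>"
| "mt_sat M t (MOr \<phi> \<psi>) \<longleftrightarrow>
     (\<exists>t' t''. t = t' \<union> t'' \<and> mt_sat M t' \<phi> \<and> mt_sat M t'' \<psi>)"
| "mt_sat M t (MImp \<phi> \<psi>) \<longleftrightarrow> (\<forall>t' \<subseteq> t. mt_sat M t' \<phi> \<longrightarrow> mt_sat M t' \<psi>)"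
| "mt_sat M t (MIOr \<phi> \<psi>) \<longleftrightarrow> mt_sat M t \<phi> \<or> mt_sat M t \<psi>"
| "mt_sat M t (MBox \<phi>) \<longleftrightarrow> (\<forall>t'. team_acc M t t' \<longrightarrow> mt_sat M t' \<phi>)"
| "mt_sat M t (MDia \<phi>) \<longleftrightarrow> (\<exists>t'. team_acc M t t' \<and> mt_sat M t' \<phi>)"

definition s4mt_valid :: "'w itself \<Rightarrow> 'p mfm \<Rightarrow> bool" where
  "s4mt_valid (_ :: 'w itself) \<phi> \<longleftrightarrow>
     (\<forall>(M :: ('w, 'p) kripke) t. s4_model M \<longrightarrow> t \<subseteq> worlds M \<longrightarrow> mt_sat M t \<phi>)"

fun box_tr :: "'p fm \<Rightarrow> 'p mfm" where
  "box_tr (Atom p) = MBox (MAtom p)"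
| "box_tr Bot = MBox MBot"
| "box_tr (And \<phi> \<psi>) = MAnd (box_tr \<phi>) (box_tr \<psi>)"
| "box_tr (Or \<phi> \<psi>) = MOr (box_tr \<phi>) (box_tr \<psi>)"
| "box_tr (IOr \<phi> \<psi>) = MIOr (box_tr \<phi>) (box_tr \<psi>)"
| "box_tr (Imp \<phi> \<psi>) = MBox (MImp (box_tr \<phi>) (box_tr \<psi>))"

end

theory Submission
  imports Defs
begin

text \<open>
  Teams of an S4 model and teams of an intuitionistic model correspond along a bounded morphism
  \<open>f\<close> for which an atom is true at \<open>f w\<close> exactly when it is necessary at \<open>w\<close>. The identity is such
  a map on an intuitionistic model, which gives one direction. For the other, an S4 model maps to
  its antisymmetric quotient, in which an atom holds at the class of \<open>w\<close> if it is necessary at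
  \<open>w\<close>. The quotient is realised on representatives, so that it stays in the same universe of
  worlds.
\<close>

lemma team_acc_Image:
  assumes "refl_on (worlds N) (acc N)" "t \<subseteq> worlds N"
  shows "team_acc N t (acc N `` t)"
  using assms unfolding team_acc_def refl_on_def by blast

text \<open>Subteams of successor teams are exactly the subsets of the largest one. This turns a box
  over \<open>MImp\<close> into the clause for \<open>Imp\<close>.\<close>

lemma team_acc_subset_iff:
  assumes "refl_on (worlds N) (acc N)" "t \<subseteq> worlds N"
  shows "(\<forall>t'. team_acc N t t' \<longrightarrow> (\<forall>s\<subseteq>t'. P s)) \<longleftrightarrow> (\<forall>s \<subseteq> acc N `` t. P s)"
  using team_acc_Image[OF assms] by (meson subset_trans team_acc_def)

text \<open>Truth of an atom passes to subteams, so the box need only be tested at the largest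
  successor team.\<close>

lemma mt_sat_box_atom_iff:
  assumes "refl_on (worlds N) (acc N)" "t \<subseteq> worlds N"
  shows "mt_sat N t (MBox (MAtom p)) \<longleftrightarrow> (\<forall>v \<in> acc N `` t. val N v p)"
  unfolding mt_sat.simps using team_acc_Image[OF assms] by (meson subsetD team_acc_def)

text \<open>By reflexivity \<open>t\<close> is a successor team of itself, and the empty team has no
  other successor team than itself.\<close>

lemma mt_sat_box_bot_iff:
  assumes "refl_on (worlds N) (acc N)" "t \<subseteq> worlds N"
  shows "mt_sat N t (MBox MBot) \<longleftrightarrow> t = {}"
proof -
  have "team_acc N t t"
    using assms unfolding team_acc_def refl_on_def by blast
  moreover have "t' = {}" if "team_acc N {} t'" for t'
    using that by (simp add: team_acc_def)
  ultimately show ?thesis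
    by auto
qed

text \<open>Needed for \<open>Or\<close>: a splitting of the image team must come from a splitting
  of the team itself.\<close>

lemma image_eq_Un_iff:
  "f ` t = a \<union> b \<longleftrightarrow> (\<exists>t' t''. t = t' \<union> t'' \<and> f ` t' = a \<and> f ` t'' = b)"
proof
  assume "f ` t = a \<union> b"
  then have "f ` t \<subseteq> a \<union> b" "a \<subseteq> f ` t" "b \<subseteq> f ` t"
    by simp_all
  \<comment> \<open>Pull both halves back along \<open>f\<close>, within \<open>t\<close>.\<close>
  then have "t = (t \<inter> f -` a) \<union> (t \<inter> f -` b) \<and> f ` (t \<inter> f -` a) = a \<and> f ` (t \<inter> f -` b) = b"
    by blast
  then show "\<exists>t' t''. t = t' \<union> t'' \<and> f ` t' = a \<and> f ` t'' = b"
    by (intro exI)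
qed (elim exE conjE, simp add: image_Un)

text \<open>Induction on the formula for all teams at once. The equation \<open>step\<close> packs
  the forth and back conditions of a bounded morphism and serves \<open>Imp\<close>;
  \<open>val\<close> serves atoms.\<close>

lemma mt_sat_box_tr_iff_inqi_support_image:
  fixes M :: "('v, 'p) kripke" and N :: "('w, 'p) kripke"
  assumes refl: "refl_on (worlds N) (acc N)" and sub: "acc N \<subseteq> worlds N \<times> worlds N"
    and step: "\<And>w. w \<in> worlds N \<Longrightarrow> acc M `` {f w} = f ` (acc N `` {w})"
    and val: "\<And>w p. w \<in> worlds N \<Longrightarrow> val M (f w) p \<longleftrightarrow> (\<forall>v \<in> acc N `` {w}. val N v p)"
    and "t \<subseteq> worlds N"
  shows "mt_sat N t (box_tr \<phi>) \<longleftrightarrow> inqi_support M (f ` t) \<phi>"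
  using \<open>t \<subseteq> worlds N\<close>
proof (induction \<phi> arbitrary: t)
  case (Atom p)
  have "(\<forall>v \<in> acc N `` t. val N v p) \<longleftrightarrow> (\<forall>w\<in>t. val M (f w) p)"
    using val Atom.prems by blast
  then show ?case
    using mt_sat_box_atom_iff[OF refl Atom.prems] by simp
next
  case Bot
  then show ?case
    using mt_sat_box_bot_iff[OF refl] by simp
next
  case (Or \<phi> \<psi>)
  have "mt_sat N t (box_tr (Or \<phi> \<psi>)) \<longleftrightarrow>
      (\<exists>t' t''. t = t' \<union> t'' \<and> inqi_support M (f ` t') \<phi> \<and> inqi_support M (f ` t'') \<psi>)"
    unfolding box_tr.simps mt_sat.simps using Or.IH Or.prems by (metis Un_subset_iff)
  also have "\<dots> \<longleftrightarrow> inqi_support M (f ` t) (Or \<phi> \<psi>)"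
    unfolding inqi_support.simps image_eq_Un_iff by blast
  finally show ?case .
next
  case (Imp \<phi> \<psi>)
  have image: "acc M `` (f ` t) = f ` (acc N `` t)"
    using step Imp.prems by blast
  have "mt_sat N t (box_tr (Imp \<phi> \<psi>)) \<longleftrightarrow>
      (\<forall>s \<subseteq> acc N `` t. mt_sat N s (box_tr \<phi>) \<longrightarrow> mt_sat N s (box_tr \<psi>))"
    using team_acc_subset_iff[OF refl Imp.prems] by simp
  also have "\<dots> \<longleftrightarrow>
      (\<forall>s \<subseteq> acc N `` t. inqi_support M (f ` s) \<phi> \<longrightarrow> inqi_support M (f ` s) \<psi>)"
  proof -
    have "s \<subseteq> worlds N" if "s \<subseteq> acc N `` t" for s
      using that sub by blast
    then show ?thesis
      using Imp.IH by simp
  qed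
  also have "\<dots> \<longleftrightarrow> inqi_support M (f ` t) (Imp \<phi> \<psi>)"
    \<comment> \<open>The subsets of an image are the images of subsets, so both sides range over
      the same teams.\<close>
    unfolding inqi_support.simps image all_subset_image ..
  finally show ?case .
qed simp_all

lemma int_model_imp_s4_model: "int_model M \<Longrightarrow> s4_model M"
  unfolding int_model_def s4_model_def modal_model_def partial_order_on_def preorder_on_def
  by blast

lemma mt_sat_box_tr_iff_inqi_support:
  assumes "int_model M" "t \<subseteq> worlds M"
  shows "mt_sat M t (box_tr \<phi>) \<longleftrightarrow> inqi_support M t \<phi>"
proof -
  have s4: "refl_on (worlds M) (acc M)" "acc M \<subseteq> worlds M \<times> worlds M"
    using int_model_imp_s4_model[OF assms(1)] by (auto simp: s4_model_def modal_model_def)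
  \<comment> \<open>Persistence gives one direction, reflexivity the other.\<close>
  have "val M w p \<longleftrightarrow> (\<forall>v \<in> acc M `` {w}. val M v p)" if "w \<in> worlds M" for w p
    using that assms(1) s4(1) unfolding int_model_def refl_on_def by blast
  then show ?thesis
    using mt_sat_box_tr_iff_inqi_support_image[of M M "\<lambda>w. w" t \<phi>] s4 assms(2) by simp
qed

definition cluster_rep :: "'w rel \<Rightarrow> 'w \<Rightarrow> 'w" where
  "cluster_rep R w = (SOME v. (w, v) \<in> R \<and> (v, w) \<in> R)"

text \<open>A representative is itself a world of \<open>N\<close>, so the valuation can refer
  directly to its successors in \<open>N\<close>.\<close>

definition skeleton :: "('w, 'p) kripke \<Rightarrow> ('w, 'p) kripke" where
  "skeleton N = \<lparr>worlds = cluster_rep (acc N) ` worlds N,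
     acc = map_prod (cluster_rep (acc N)) (cluster_rep (acc N)) ` acc N,
     val = (\<lambda>w p. \<forall>v \<in> acc N `` {w}. val N v p)\<rparr>"

lemma cluster_rep_acc:
  assumes "s4_model N" "w \<in> worlds N"
  shows "(w, cluster_rep (acc N) w) \<in> acc N" "(cluster_rep (acc N) w, w) \<in> acc N"
proof -
  \<comment> \<open>This is the choice predicate with \<open>w\<close> as witness, hence the
    repeated conjunct.\<close>
  have "(w, w) \<in> acc N \<and> (w, w) \<in> acc N"
    using assms by (simp add: s4_model_def refl_on_def)
  then have "(w, cluster_rep (acc N) w) \<in> acc N \<and> (cluster_rep (acc N) w, w) \<in> acc N"
    unfolding cluster_rep_def by (rule someI)
  then show "(w, cluster_rep (acc N) w) \<in> acc N" "(cluster_rep (acc N) w, w) \<in> acc N"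
    by simp_all
qed

text \<open>Mutually accessible worlds have the same choice predicate, so \<open>SOME\<close>
  returns the same element.\<close>

lemma cluster_rep_eqI:
  assumes "trans R" "(v, w) \<in> R" "(w, v) \<in> R"
  shows "cluster_rep R v = cluster_rep R w"
proof -
  have "(v, x) \<in> R \<and> (x, v) \<in> R \<longleftrightarrow> (w, x) \<in> R \<and> (x, w) \<in> R" for x
    using assms by (meson transE)
  then show ?thesis
    by (simp add: cluster_rep_def)
qed

text \<open>An edge of the skeleton may stem from other members of the two clusters; transitivity
  carries it over to \<open>v\<close> and \<open>w\<close>.\<close>

lemma acc_skeleton_iff:
  assumes N: "s4_model N" and "v \<in> worlds N" "w \<in> worlds N"
  shows "(cluster_rep (acc N) v, cluster_rep (acc N) w) \<in> acc (skeleton N) \<longleftrightarrow> (v, w) \<in> acc N"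
proof
  assume "(cluster_rep (acc N) v, cluster_rep (acc N) w) \<in> acc (skeleton N)"
  then obtain v' w' where *: "(v', w') \<in> acc N"
    "cluster_rep (acc N) v' = cluster_rep (acc N) v"
    "cluster_rep (acc N) w' = cluster_rep (acc N) w"
    by (auto simp: skeleton_def)
  have trans: "trans (acc N)" and "v' \<in> worlds N" "w' \<in> worlds N"
    using N *(1) by (auto simp: s4_model_def modal_model_def)
  \<comment> \<open>The shared representatives yield the path from \<open>v\<close> to
    \<open>v'\<close>, on to \<open>w'\<close>, and then to \<open>w\<close>.\<close>
  then have "(v, cluster_rep (acc N) v) \<in> acc N" "(cluster_rep (acc N) v, v') \<in> acc N"
    "(w', cluster_rep (acc N) w) \<in> acc N" "(cluster_rep (acc N) w, w) \<in> acc N"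
    using cluster_rep_acc[OF N] assms(2,3) * by metis+
  then show "(v, w) \<in> acc N"
    using trans *(1) by (meson transE)
qed (force simp: skeleton_def)

text \<open>A world and its representative see the same worlds, by transitivity.\<close>

lemma val_skeleton_iff:
  assumes N: "s4_model N" and "w \<in> worlds N"
  shows "val (skeleton N) (cluster_rep (acc N) w) p \<longleftrightarrow> (\<forall>v \<in> acc N `` {w}. val N v p)"
proof -
  have "trans (acc N)"
    using N by (simp add: s4_model_def)
  then have "acc N `` {cluster_rep (acc N) w} = acc N `` {w}"
    using cluster_rep_acc[OF assms] by (blast dest: transD)
  then show ?thesis
    by (simp add: skeleton_def)
qed

text \<open>The preorder laws transfer from \<open>N\<close>. Antisymmetry holds since mutually
  accessible worlds share a representative, persistence since successors of a successor are
  successors.\<close>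

lemma int_model_skeleton:
  assumes N: "s4_model N"
  shows "int_model (skeleton N)"
proof -
  let ?r = "cluster_rep (acc N)"
  have sub: "acc N \<subseteq> worlds N \<times> worlds N" and refl: "refl_on (worlds N) (acc N)"
    and trans: "trans (acc N)"
    using N by (simp_all add: s4_model_def modal_model_def)
  have W: "worlds (skeleton N) = ?r ` worlds N"
    by (simp add: skeleton_def)
  have A: "acc (skeleton N) \<subseteq> worlds (skeleton N) \<times> worlds (skeleton N)"
    using sub by (auto simp: skeleton_def)
  have "refl_on (worlds (skeleton N)) (acc (skeleton N))"
    unfolding refl_on_def W using acc_skeleton_iff[OF N] refl by (simp add: refl_on_def)
  moreover have "trans (acc (skeleton N))"
  proof (rule transI)
    fix x y z assume xy: "(x, y) \<in> acc (skeleton N)" and yz: "(y, z) \<in> acc (skeleton N)"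
    then obtain x' y' z' where "x = ?r x'" "y = ?r y'" "z = ?r z'"
      and "x' \<in> worlds N" "y' \<in> worlds N" "z' \<in> worlds N"
      using A unfolding W by blast
    then show "(x, z) \<in> acc (skeleton N)"
      using xy yz acc_skeleton_iff[OF N] trans by (metis transE)
  qed
  moreover have "antisym (acc (skeleton N))"
  proof (rule antisymI)
    fix x y assume xy: "(x, y) \<in> acc (skeleton N)" and yx: "(y, x) \<in> acc (skeleton N)"
    then obtain x' y' where "x = ?r x'" "y = ?r y'" "x' \<in> worlds N" "y' \<in> worlds N"
      using A unfolding W by blast
    then show "x = y"
      using xy yx acc_skeleton_iff[OF N] cluster_rep_eqI[OF trans] by metis
  qed
  moreover have "val (skeleton N) y p"
    if xy: "(x, y) \<in> acc (skeleton N)" and x: "val (skeleton N) x p" for x y p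
  proof -
    obtain x' y' where *: "x = ?r x'" "y = ?r y'" "x' \<in> worlds N" "y' \<in> worlds N"
      using A xy unfolding W by blast
    then have "(x', y') \<in> acc N"
      using xy acc_skeleton_iff[OF N] by metis
    then show ?thesis
      using x * val_skeleton_iff[OF N] trans by (auto dest: transD)
  qed
  ultimately show ?thesis
    using A by (simp add: int_model_def partial_order_on_def preorder_on_def)
qed

text \<open>The map to representatives is a bounded morphism: \<open>acc_skeleton_iff\<close> gives
  \<open>step\<close> and \<open>val_skeleton_iff\<close> gives \<open>val\<close>.\<close>

lemma mt_sat_box_tr_iff_skeleton:
  assumes N: "s4_model N" and "t \<subseteq> worlds N"
  shows "mt_sat N t (box_tr \<phi>) \<longleftrightarrow> inqi_support (skeleton N) (cluster_rep (acc N) ` t) \<phi>"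
proof (rule mt_sat_box_tr_iff_inqi_support_image)
  let ?r = "cluster_rep (acc N)"
  show "refl_on (worlds N) (acc N)" and sub: "acc N \<subseteq> worlds N \<times> worlds N"
    using N by (simp_all add: s4_model_def modal_model_def)
  show "acc (skeleton N) `` {?r w} = ?r ` (acc N `` {w})" if w: "w \<in> worlds N" for w
  proof
    show "acc (skeleton N) `` {?r w} \<subseteq> ?r ` (acc N `` {w})"
    proof
      fix u assume "u \<in> acc (skeleton N) `` {?r w}"
      moreover from this obtain v where "u = ?r v" "v \<in> worlds N"
        using sub by (auto simp: skeleton_def)
      ultimately show "u \<in> ?r ` (acc N `` {w})"
        using acc_skeleton_iff[OF N w] by auto
    qed
    show "?r ` (acc N `` {w}) \<subseteq> acc (skeleton N) `` {?r w}"
      using acc_skeleton_iff[OF N w] sub by auto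
  qed
qed (use assms val_skeleton_iff[OF N] in auto)

theorem theorem4p28:
  fixes \<phi> :: "'p fm"
  shows "inqi_valid TYPE('w) \<phi> \<longleftrightarrow> s4mt_valid TYPE('w) (box_tr \<phi>)"
proof
  assume valid: "inqi_valid TYPE('w) \<phi>"
  show "s4mt_valid TYPE('w) (box_tr \<phi>)"
    unfolding s4mt_valid_def
  proof (intro allI impI)
    fix N :: "('w, 'p) kripke" and t
    assume N: "s4_model N" and t: "t \<subseteq> worlds N"
    have "cluster_rep (acc N) ` t \<subseteq> worlds (skeleton N)"
      using t by (auto simp: skeleton_def)
    then have "inqi_support (skeleton N) (cluster_rep (acc N) ` t) \<phi>"
      using valid int_model_skeleton[OF N] by (simp add: inqi_valid_def)
    then show "mt_sat N t (box_tr \<phi>)"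
      using mt_sat_box_tr_iff_skeleton[OF N t] by simp
  qed
next
  assume "s4mt_valid TYPE('w) (box_tr \<phi>)"
  then show "inqi_valid TYPE('w) \<phi>"
    unfolding s4mt_valid_def inqi_valid_def
    using int_model_imp_s4_model mt_sat_box_tr_iff_inqi_support by blast
qed

end
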